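(* $[d(bv)]^{\alpha}=\int \ell_{1}$.
   Context: All sequences are complex sequences $x=(x_k)_{k\ge 1}$; $\omega$ is the space of all of them. Define $d(bv)=\{x\in\omega:\sum_{k\ge1}|k^{-1}x_k-(k-1)^{-1}x_{k-1}|<\infty\}$, where the term for $k=1$ is read as $|x_1|$, and $\int\ell_1=\{x\in\omega:\sum_{k\ge1}|k x_k|<\infty\}$. For $X\subset\omega$, the $\alpha$-dual is $X^{\alpha}=\{a\in\omega:\sum_{k}|a_kx_k|<\infty\text{ for all }x\in X\}$. *)

theory Defs
  imports "HOL-Analysis.Infinite_Sum"
begin

text \<open>A complex sequence \<open>(x\<^sub>k)\<close>, \<open>k \<ge> 1\<close>, is a function on the natural numbers. The
  unused entry at index 0 is normalised to 0, so that each sequence has exactly one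
  representation. All series run over \<open>k \<ge> 1\<close>; their terms are nonnegative reals,
  so unordered summability is ordinary convergence.\<close>

definition omega :: "(nat \<Rightarrow> complex) set" where
  "omega = {x. x 0 = 0}"

definition alpha_dual :: "(nat \<Rightarrow> complex) set \<Rightarrow> (nat \<Rightarrow> complex) set" where
  "alpha_dual X = {a \<in> omega. \<forall>x\<in>X. (\<lambda>k. cmod (a k * x k)) summable_on {1..}}"

definition d_bv :: "(nat \<Rightarrow> complex) set" where
  "d_bv = {x \<in> omega.
     (\<lambda>k. if k = 1 then cmod (x 1)
          else cmod (x k / of_nat k - x (k - 1) / of_nat (k - 1))) summable_on {1..}}"

definition int_l1 :: "(nat \<Rightarrow> complex) set" where
  "int_l1 = {x \<in> omega. (\<lambda>k. cmod (of_nat k * x k)) summable_on {1..}}"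

end

theory Submission
  imports Defs
begin

text \<open>Membership of x in \<open>d_bv\<close> says that the quotients x_k / k have bounded
  variation, so they are bounded by some C (\<open>d_bv_imp_bounded_quotients\<close>). Then |a_k
  x_k| = |x_k / k| |k a_k| \<le> C |k a_k|, and every a in \<open>int_l1\<close> lies in the dual.
  Conversely, the single test sequence x_k = k lies in \<open>d_bv\<close>
  (\<open>of_nat_in_d_bv\<close>), and pairing a with it gives exactly the series that defines
  \<open>int_l1\<close>.\<close>

lemma bounded_variation_summable_imp_bounded:
  fixes y :: "nat \<Rightarrow> complex"
  assumes y0: "y 0 = 0"
    and sm: "(\<lambda>k. cmod (y k - y (k - 1))) summable_on {1..}"
  shows "cmod (y n) \<le> (\<Sum>\<^sub>\<infinity>k\<in>{1..}. cmod (y k - y (k - 1)))"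
proof -
  \<comment> \<open>Telescoping from y_0 = 0: y_n is the sum of its first n increments.\<close>
  have "cmod (y n) \<le> (\<Sum>k\<in>{1..n}. cmod (y k - y (k - 1)))"
  proof (induction n)
    case 0
    then show ?case by (simp add: y0)
  next
    case (Suc n)
    have "cmod (y (Suc n)) \<le> cmod (y n) + cmod (y (Suc n) - y n)"
      by (rule norm_triangle_sub)
    with Suc show ?case by simp
  qed
  also have "\<dots> \<le> (\<Sum>\<^sub>\<infinity>k\<in>{1..}. cmod (y k - y (k - 1)))"
    by (rule finite_sum_le_infsum[OF sm]) auto
  finally show ?thesis .
qed

text \<open>All quotients k / k with k \<ge> 1 equal 1, so only the term at k = 1 of the variation
  series survives.\<close>

lemma of_nat_in_d_bv: "of_nat \<in> d_bv"
proof -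
  have "(\<lambda>k::nat. if k = 1 then cmod (of_nat 1)
      else cmod (of_nat k / of_nat k - of_nat (k - 1) / of_nat (k - 1))) summable_on {1..}
    \<longleftrightarrow> (\<lambda>k::nat. if k = 1 then 1 else 0::real) summable_on {1}"
    by (rule summable_on_cong_neutral) auto
  then show ?thesis by (simp add: d_bv_def omega_def)
qed

lemma d_bv_imp_bounded_quotients:
  assumes "x \<in> d_bv"
  obtains C where "\<And>k. cmod (x k / of_nat k) \<le> C"
proof -
  define y where "y k = x k / of_nat k" for k
  \<comment> \<open>Division by zero yields 0, so y_0 = 0 and the increment at k = 1 is x_1: the
    separately defined first term fits the general pattern.\<close>
  have "(\<lambda>k. cmod (y k - y (k - 1))) summable_on {1..}
    \<longleftrightarrow> (\<lambda>k. if k = 1 then cmod (x 1)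
          else cmod (x k / of_nat k - x (k - 1) / of_nat (k - 1))) summable_on {1..}"
    by (rule summable_on_cong) (auto simp: y_def)
  then have "(\<lambda>k. cmod (y k - y (k - 1))) summable_on {1..}"
    using assms by (simp add: d_bv_def)
  moreover have "y 0 = 0" by (simp add: y_def)
  ultimately have "\<And>k. cmod (y k) \<le> (\<Sum>\<^sub>\<infinity>k\<in>{1..}. cmod (y k - y (k - 1)))"
    by (intro bounded_variation_summable_imp_bounded)
  then show ?thesis
    by (intro that) (simp add: y_def)
qed

theorem theorem3p5: "alpha_dual d_bv = int_l1"
proof (intro equalityI subsetI)
  fix a assume "a \<in> alpha_dual d_bv"
  then show "a \<in> int_l1"
    \<comment> \<open>The dual condition is instantiated at x = \<open>of_nat\<close>.\<close>
    using of_nat_in_d_bv by (auto simp: alpha_dual_def int_l1_def mult.commute)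
next
  fix a assume a: "a \<in> int_l1"
  have "(\<lambda>k. cmod (a k * x k)) summable_on {1..}" if x: "x \<in> d_bv" for x
  proof -
    obtain C where C: "cmod (x k / of_nat k) \<le> C" for k
      using d_bv_imp_bounded_quotients[OF x] by blast
    have "(\<lambda>k. C * cmod (of_nat k * a k)) summable_on {1..}"
      using a by (intro summable_on_cmult_right) (simp add: int_l1_def)
    then show ?thesis
    proof (rule summable_on_comparison_test)
      fix k :: nat assume "k \<in> {1..}"
      \<comment> \<open>Cancelling k is legitimate because k \<ge> 1.\<close>
      then have "a k * x k = (x k / of_nat k) * (of_nat k * a k)" by simp
      then have "cmod (a k * x k) = cmod (x k / of_nat k) * cmod (of_nat k * a k)"
        by (simp only: norm_mult)
      also have "\<dots> \<le> C * cmod (of_nat k * a k)"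
        by (rule mult_right_mono[OF C]) simp
      finally show "cmod (a k * x k) \<le> C * cmod (of_nat k * a k)" .
    qed auto
  qed
  with a show "a \<in> alpha_dual d_bv"
    by (simp add: alpha_dual_def int_l1_def)
qed

end
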